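(* Let $F^n=(M,F)$ be a Finsler space, $i:\check M\to M$ an immersed $m$-dimensional manifold ($1<m<n$), and $D$ the Cartan metrical $N$-linear connection on $\widetilde{OscM}$. The normal connection 1-forms $\omega^{H\,\bar\alpha}{}_{\bar\beta},\omega^{V\,\bar\alpha}{}_{\bar\beta}$ of the induced normal connection on $\widetilde{Osc\check M}$ are $$\omega^{H\,\bar\alpha}{}_{\bar\beta}=L^{H\,\bar\alpha}{}_{\bar\beta\delta}\,du^\delta+C^{H\,\bar\alpha}{}_{\bar\beta\delta}\,\delta v^\delta,\qquad \omega^{V\,\bar\alpha}{}_{\bar\beta}=L^{V\,\bar\alpha}{}_{\bar\beta\delta}\,du^\delta+C^{V\,\bar\alpha}{}_{\bar\beta\delta}\,\delta v^\delta,$$ where $$L^{H\,\bar\alpha}{}_{\bar\beta\delta}=B^{\bar\alpha}_d\left(\frac{\delta B^d_{\bar\beta}}{\delta u^\delta}+B^f_{\bar\beta}\check L^{H\,d}{}_{f\delta}\right),\qquad L^{V\,\bar\alpha}{}_{\bar\beta\delta}=B^{\bar\alpha}_d\left(\frac{\delta B^d_{\bar\beta}}{\delta u^\delta}+B^f_{\bar\beta}\check L^{V\,d}{}_{f\delta}\right),$$ $$C^{H\,\bar\alpha}{}_{\bar\beta\delta}=B^{\bar\alpha}_d\left(\frac{\partial B^d_{\bar\beta}}{\partial v^\delta}+B^f_{\bar\beta}\check C^{H\,d}{}_{f\delta}\right),\qquad C^{V\,\bar\alpha}{}_{\bar\beta\delta}=B^{\bar\alpha}_d\left(\frac{\partial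 B^d_{\bar\beta}}{\partial v^\delta}+B^f_{\bar\beta}\check C^{V\,d}{}_{f\delta}\right).$$
   Context: Summation convention throughout. Indices $a,b,c,d,f$ run over $1,\dots,n$; $\alpha,\beta,\gamma,\delta$ over $1,\dots,m$; barred indices over $1,\dots,n-m$. Ambient space. $M$ is a real $n$-manifold, $OscM=TM$ with local coordinates $(x^a,y^a)$, $\widetilde{OscM}=TM\setminus\{0\}$. $F$ is a Finsler fundamental function on $M$ (smooth on $\widetilde{OscM}$, continuous on the null section), $g_{ab}=\frac12\frac{\partial^2F^2}{\partial y^a\partial y^b}$, $\gamma^a_{bc}(x,y)$ are the Christoffel symbols of $g_{ab}$ formed with $x$-derivatives, $G^a=\frac12\gamma^a_{bc}y^by^c$, and $N^a{}_b=\partial G^a/\partial y^b$ is the Cartan nonlinear connection. Put $\dot\partial_a=\partial/\partial y^a$, $\delta_a=\partial/\partial x^a-N^b{}_a\dot\partial_b$, $\delta y^a=dy^a+N^a{}_bdx^b$. Let $p>0$ be a constant, $\|y\|^2=g_{ab}y^ay^b$, $h_{ab}=\frac{p^2}{\|y\|^2}g_{ab}$, with inverse $h^{ab}$. The Cartan metrical $N$-linear connection $D$ (of the lift $g_{ab}dx^a\otimes dx^b+h_{ab}\delta y^a\otimes\delta y^b$) has the coefficients $L^{H\,a}{}_{bc}=\frac12g^{ad}(\delta_bg_{dc}+\delta_cg_{bd}-\delta_dg_{bc})$, $L^{V\,a}{}_{bc}=\frac12h^{ad}(\delta_bh_{dc}+\delta_ch_{bd}-\delta_dh_{bc})$, $C^{H\,a}{}_{bc}=\frac12g^{ad}(\dot\partial_bg_{dc}+\dot\partial_cg_{bd}-\dot\partial_dg_{bc})$,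 $C^{V\,a}{}_{bc}=\frac12h^{ad}(\dot\partial_bh_{dc}+\dot\partial_ch_{bd}-\dot\partial_dh_{bc})$. Submanifold. $i$ is locally $x^a=x^a(u^1,\dots,u^m)$ with $B^a_\alpha=\partial x^a/\partial u^\alpha$ of rank $m$; $Osc\check M=T\check M$ with coordinates $(u^\alpha,v^\alpha)$ is immersed in $OscM$ by $x^a=x^a(u)$, $y^a=B^a_\alpha v^\alpha$; $\widetilde{Osc\check M}=T\check M\setminus\{0\}$. Along it one fixes a local moving frame $\{B^a_\alpha(u),B^a_{\bar\alpha}(u,v)\}$ with dual frame $\{B^\alpha_a(u,v),B^{\bar\alpha}_a(u,v)\}$: $B^a_\beta B^\alpha_a=\delta^\alpha_\beta$, $B^a_\beta B^{\bar\alpha}_a=0$, $B^\alpha_aB^a_{\bar\beta}=0$, $B^{\bar\alpha}_aB^a_{\bar\beta}=\delta^{\bar\alpha}_{\bar\beta}$, $B^a_\alpha B^\alpha_b+B^a_{\bar\alpha}B^{\bar\alpha}_b=\delta^a_b$. Put $B^a_{\alpha\beta}=\partial^2x^a/\partial u^\alpha\partial u^\beta$, $B^a_{0\beta}=B^a_{\alpha\beta}v^\alpha$. The induced nonlinear connection is $\check N^\alpha{}_\beta=B^\alpha_a(B^a_{0\beta}+N^a{}_bB^b_\beta)$; $\delta v^\alpha=dv^\alpha+\check N^\alpha{}_\beta du^\beta$, $\frac{\delta}{\delta u^\delta}=\frac{\partial}{\partial u^\delta}-\check N^\beta{}_\delta\frac{\partial}{\partial v^\beta}$, and $K^{\bar\alpha}_\beta=B^{\bar\alpha}_a(B^a_{0\beta}+N^a{}_bB^b_\beta)$.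 (All ambient functions are evaluated along the submanifold.) Coupling. For $X^a$ defined along $\widetilde{Osc\check M}$, $\check D^HX^a=dX^a+\check\omega^{H\,a}{}_bX^b$ and $\check D^VX^a=dX^a+\check\omega^{V\,a}{}_bX^b$, where $\check\omega^{H\,a}{}_b=\check L^{H\,a}{}_{b\delta}du^\delta+\check C^{H\,a}{}_{b\delta}\delta v^\delta$, $\check\omega^{V\,a}{}_b=\check L^{V\,a}{}_{b\delta}du^\delta+\check C^{V\,a}{}_{b\delta}\delta v^\delta$, with $\check L^{H\,a}{}_{b\delta}=L^{H\,a}{}_{bd}B^d_\delta+C^{H\,a}{}_{bd}B^d_{\bar\delta}K^{\bar\delta}_\delta$, $\check L^{V\,a}{}_{b\delta}=L^{V\,a}{}_{bd}B^d_\delta+C^{V\,a}{}_{bd}B^d_{\bar\delta}K^{\bar\delta}_\delta$, $\check C^{H\,a}{}_{b\delta}=C^{H\,a}{}_{bd}B^d_\delta$, $\check C^{V\,a}{}_{b\delta}=C^{V\,a}{}_{bd}B^d_\delta$. Induced normal connection. It is the pair of operators $D^{\bot H},D^{\bot V}$ defined by $D^{\bot H}X^{\bar\alpha}=B^{\bar\alpha}_b\check D^HX^b$, $D^{\bot V}X^{\bar\alpha}=B^{\bar\alpha}_b\check D^VX^b$ for $X^a=B^a_{\bar\gamma}X^{\bar\gamma}$. Its normal connection 1-forms are the 1-forms with $D^{\bot H}X^{\bar\alpha}=dX^{\bar\alpha}+X^{\bar\beta}\omega^{H\,\bar\alpha}{}_{\bar\beta}$, $D^{\bot V}X^{\bar\alpha}=dX^{\bar\alpha}+X^{\bar\beta}\omega^{V\,\bar\alpha}{}_{\bar\beta}$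 for all $X^{\bar\alpha}$. *)

theory Defs
  imports "HOL-Analysis.Analysis"
begin

section \<open>Smooth maps and partial derivatives\<close>

fun Ck_on :: "nat \<Rightarrow> ('a::real_normed_vector \<Rightarrow> 'b::real_normed_vector) \<Rightarrow> 'a set \<Rightarrow> bool" where
  "Ck_on 0 f S \<longleftrightarrow> continuous_on S f"
| "Ck_on (Suc k) f S \<longleftrightarrow>
     (\<forall>z\<in>S. f differentiable (at z)) \<and> (\<forall>v. Ck_on k (\<lambda>z. frechet_derivative f (at z) v) S)"

text \<open>Only used for open \<^term>\<open>S\<close>.\<close>
definition smooth_on :: "'a::real_normed_vector set \<Rightarrow> ('a \<Rightarrow> 'b::real_normed_vector) \<Rightarrow> bool" where
  "smooth_on S f \<longleftrightarrow> (\<forall>k. Ck_on k f S)"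

definition partial :: "'i::finite \<Rightarrow> (real^'i \<Rightarrow> real) \<Rightarrow> real^'i \<Rightarrow> real" where
  "partial i f x = frechet_derivative f (at x) (axis i 1)"

type_synonym 'i tb = "(real^'i) \<times> (real^'i)"

text \<open>A point of a tangent bundle is given in induced coordinates by a pair (position, direction).
  The next two operators are the partial derivatives with respect to the position and
  the direction coordinates: \<open>\<partial>/\<partial>x\<^sup>a\<close> and \<open>\<partial>/\<partial>y\<^sup>a\<close> on \<open>TM\<close>,
  \<open>\<partial>/\<partial>u\<^sup>\<alpha>\<close> and \<open>\<partial>/\<partial>v\<^sup>\<alpha>\<close> on the tangent bundle of the submanifold.\<close>

definition pd_pos :: "'i::finite \<Rightarrow> ('i tb \<Rightarrow> real) \<Rightarrow> 'i tb \<Rightarrow> real" where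
  "pd_pos i f z = frechet_derivative f (at z) (axis i 1, 0)"

definition pd_dir :: "'i::finite \<Rightarrow> ('i tb \<Rightarrow> real) \<Rightarrow> 'i tb \<Rightarrow> real" where
  "pd_dir i f z = frechet_derivative f (at z) (0, axis i 1)"


section \<open>Manifolds, tangent bundles, Finsler functions, immersions\<close>

text \<open>A chart is a pair of an open domain and a coordinate map (relevant only on that domain);
  the manifold is the whole type \<open>'p\<close>, and its dimension is \<open>CARD('n)\<close>.\<close>
type_synonym ('p, 'n) chart = "'p set \<times> ('p \<Rightarrow> real^'n)"

definition chart_inv :: "('p, 'n::finite) chart \<Rightarrow> real^'n \<Rightarrow> 'p" where
  "chart_inv c = inv_into (fst c) (snd c)"

definition is_chart :: "('p::topological_space, 'n::finite) chart \<Rightarrow> bool" where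
  "is_chart c \<longleftrightarrow> open (fst c) \<and> open (snd c ` fst c) \<and>
     homeomorphism (fst c) (snd c ` fst c) (snd c) (chart_inv c)"

definition smooth_atlas :: "('p::topological_space, 'n::finite) chart set \<Rightarrow> bool" where
  "smooth_atlas A \<longleftrightarrow> (\<forall>c\<in>A. is_chart c) \<and> (\<Union>c\<in>A. fst c) = UNIV \<and>
     (\<forall>c\<in>A. \<forall>c'\<in>A. smooth_on (snd c ` (fst c \<inter> fst c')) (snd c' \<circ> chart_inv c))"

text \<open>A tangent vector at a point is the family of its components in all charts around the point,
  related by the contravariant transformation law; \<open>tangent_vec A c q y\<close> is the vector at
  \<open>q\<close> whose components in the chart \<open>c\<close> are \<open>y\<close>. A function on \<open>TM\<close> is then a function of
  a point and such a family.\<close>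
type_synonym ('p, 'n) tvec = "('p, 'n) chart \<Rightarrow> real^'n"

definition tangent_vec ::
    "('p, 'n::finite) chart set \<Rightarrow> ('p, 'n) chart \<Rightarrow> 'p \<Rightarrow> real^'n \<Rightarrow> ('p, 'n) tvec" where
  "tangent_vec A c q y = (\<lambda>c'. if c' \<in> A \<and> q \<in> fst c'
     then frechet_derivative (snd c' \<circ> chart_inv c) (at (snd c q)) y else 0)"

definition local_rep ::
    "('p, 'n::finite) chart set \<Rightarrow> ('p \<Rightarrow> ('p, 'n) tvec \<Rightarrow> real) \<Rightarrow> ('p, 'n) chart \<Rightarrow>
     'n tb \<Rightarrow> real" where
  "local_rep A F c = (\<lambda>(x, y). F (chart_inv c x) (tangent_vec A c (chart_inv c x) y))"

text \<open>\<open>g\<^sub>a\<^sub>b = (1/2) \<partial>\<^sup>2F\<^sup>2/\<partial>y\<^sup>a\<partial>y\<^sup>b\<close>, for \<open>f\<close> the local representative of \<open>F\<close>.\<close>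
definition fundamental_tensor ::
    "('n::finite tb \<Rightarrow> real) \<Rightarrow> 'n tb \<Rightarrow> real^'n^'n" where
  "fundamental_tensor f z = (\<chi> a b. 1/2 * pd_dir a (pd_dir b (\<lambda>w. (f w)\<^sup>2)) z)"

definition finsler_function ::
    "('p::topological_space, 'n::finite) chart set \<Rightarrow> ('p \<Rightarrow> ('p, 'n) tvec \<Rightarrow> real) \<Rightarrow> bool" where
  "finsler_function A F \<longleftrightarrow> (\<forall>c\<in>A. let f = local_rep A F c; U = snd c ` fst c in
     smooth_on (U \<times> (UNIV - {0})) f \<and>
     continuous_on (U \<times> UNIV) f \<and>
     (\<forall>x\<in>U. \<forall>y. y \<noteq> 0 \<longrightarrow> 0 < f (x, y)) \<and>
     (\<forall>x\<in>U. \<forall>y. \<forall>t>0. f (x, t *\<^sub>R y) = t * f (x, y)) \<and>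
     (\<forall>x\<in>U. \<forall>y. y \<noteq> 0 \<longrightarrow>
        (\<forall>w. w \<noteq> 0 \<longrightarrow> 0 < w \<bullet> (fundamental_tensor f (x, y) *v w))))"

text \<open>Local expression \<open>x\<^sup>a = x\<^sup>a(u)\<close> of a map between manifolds and its domain.\<close>

definition local_map ::
    "('q, 'm::finite) chart \<Rightarrow> ('p, 'n::finite) chart \<Rightarrow> ('q \<Rightarrow> 'p) \<Rightarrow> real^'m \<Rightarrow> real^'n" where
  "local_map c' c i = snd c \<circ> i \<circ> chart_inv c'"

definition local_dom ::
    "('q, 'm::finite) chart \<Rightarrow> ('p, 'n::finite) chart \<Rightarrow> ('q \<Rightarrow> 'p) \<Rightarrow> (real^'m) set" where
  "local_dom c' c i = snd c' ` (fst c' \<inter> i -` fst c)"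

definition smooth_immersion ::
    "('q::topological_space, 'm::finite) chart set \<Rightarrow> ('p::topological_space, 'n::finite) chart set \<Rightarrow>
     ('q \<Rightarrow> 'p) \<Rightarrow> bool" where
  "smooth_immersion A' A i \<longleftrightarrow> continuous_on UNIV i \<and>
     (\<forall>c'\<in>A'. \<forall>c\<in>A. smooth_on (local_dom c' c i) (local_map c' c i) \<and>
        (\<forall>u\<in>local_dom c' c i. inj (frechet_derivative (local_map c' c i) (at u))))"


section \<open>The Cartan metrical N-linear connection\<close>

text \<open>Throughout, \<open>f\<close> is the representative of \<open>F\<close> in a chart of \<open>M\<close>. The common shape
  \<open>(1/2) G\<^sup>a\<^sup>d (D\<^sub>b G\<^sub>d\<^sub>c + D\<^sub>c G\<^sub>b\<^sub>d - D\<^sub>d G\<^sub>b\<^sub>c)\<close> of all the Christoffel-type coefficients, for a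
  metric \<open>G\<close> and derivations \<open>D\<^sub>a\<close>.\<close>
definition christoffel ::
    "('n::finite \<Rightarrow> ('n tb \<Rightarrow> real) \<Rightarrow> 'n tb \<Rightarrow> real) \<Rightarrow>
     ('n tb \<Rightarrow> real^'n^'n) \<Rightarrow> 'n \<Rightarrow> 'n \<Rightarrow> 'n \<Rightarrow> 'n tb \<Rightarrow> real" where
  "christoffel D G a b c z = 1/2 * (\<Sum>d\<in>UNIV. matrix_inv (G z) $ a $ d *
     (D b (\<lambda>w. G w $ d $ c) z + D c (\<lambda>w. G w $ b $ d) z - D d (\<lambda>w. G w $ b $ c) z))"

definition spray :: "('n::finite tb \<Rightarrow> real) \<Rightarrow> 'n \<Rightarrow> 'n tb \<Rightarrow> real" where
  "spray f a z = 1/2 * (\<Sum>b\<in>UNIV. \<Sum>c\<in>UNIV.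
     christoffel pd_pos (fundamental_tensor f) a b c z * (snd z $ b) * (snd z $ c))"

text \<open>\<open>cartan_N f a b\<close> is \<open>N\<^sup>a\<^sub>b = \<partial>G\<^sup>a/\<partial>y\<^sup>b\<close>.\<close>
definition cartan_N ::
    "('n::finite tb \<Rightarrow> real) \<Rightarrow> 'n \<Rightarrow> 'n \<Rightarrow> 'n tb \<Rightarrow> real" where
  "cartan_N f a b = pd_dir b (spray f a)"

text \<open>\<open>\<delta>\<^sub>a = \<partial>/\<partial>x\<^sup>a - N\<^sup>b\<^sub>a \<partial>/\<partial>y\<^sup>b\<close>.\<close>
definition delta_x :: "('n::finite tb \<Rightarrow> real) \<Rightarrow> 'n \<Rightarrow>
     ('n tb \<Rightarrow> real) \<Rightarrow> 'n tb \<Rightarrow> real" where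
  "delta_x f a s z = pd_pos a s z - (\<Sum>b\<in>UNIV. cartan_N f b a z * pd_dir b s z)"

definition normsq :: "('n::finite tb \<Rightarrow> real) \<Rightarrow> 'n tb \<Rightarrow> real" where
  "normsq f z = (\<Sum>a\<in>UNIV. \<Sum>b\<in>UNIV. fundamental_tensor f z $ a $ b * (snd z $ a) * (snd z $ b))"

definition h_metric ::
    "real \<Rightarrow> ('n::finite tb \<Rightarrow> real) \<Rightarrow> 'n tb \<Rightarrow> real^'n^'n" where
  "h_metric p f z = (\<chi> a b. p\<^sup>2 / normsq f z * fundamental_tensor f z $ a $ b)"

text \<open>In the following, the index order \<open>a b c\<close> stands for \<open>L\<^sup>a\<^sub>b\<^sub>c\<close>, \<open>C\<^sup>a\<^sub>b\<^sub>c\<close>.\<close>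

type_synonym 'n coeffs = "'n \<Rightarrow> 'n \<Rightarrow> 'n \<Rightarrow> 'n tb \<Rightarrow> real"

definition cartan_LH :: "('n::finite tb \<Rightarrow> real) \<Rightarrow> 'n coeffs" where
  "cartan_LH f = christoffel (delta_x f) (fundamental_tensor f)"

definition cartan_LV :: "real \<Rightarrow> ('n::finite tb \<Rightarrow> real) \<Rightarrow> 'n coeffs" where
  "cartan_LV p f = christoffel (delta_x f) (h_metric p f)"

definition cartan_CH :: "('n::finite tb \<Rightarrow> real) \<Rightarrow> 'n coeffs" where
  "cartan_CH f = christoffel pd_dir (fundamental_tensor f)"

definition cartan_CV :: "real \<Rightarrow> ('n::finite tb \<Rightarrow> real) \<Rightarrow> 'n coeffs" where
  "cartan_CV p f = christoffel pd_dir (h_metric p f)"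


section \<open>Induced objects along the submanifold\<close>

text \<open>Here \<open>x\<close> is the local expression of the immersion and \<open>z = (u, v)\<close>. The frame is given by
  the vectors \<open>E \<alpha>' z\<close> with components \<open>B\<^sup>a\<^sub>\<alpha>\<^sub>'\<close> (barred index \<open>\<alpha>'\<close>, of type \<open>'k\<close>), the dual frame by
  \<open>T \<alpha> z\<close> with components \<open>B\<^sup>\<alpha>\<^sub>a\<close> and \<open>Q \<alpha>' z\<close> with components \<open>B\<^sup>\<alpha>\<^sup>'\<^sub>a\<close>.\<close>

definition B_tan :: "(real^'m::finite \<Rightarrow> real^'n::finite) \<Rightarrow> 'n \<Rightarrow> 'm \<Rightarrow> real^'m \<Rightarrow> real" where
  "B_tan x a \<alpha> = partial \<alpha> (\<lambda>u. x u $ a)"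

definition lift_map ::
    "(real^'m::finite \<Rightarrow> real^'n::finite) \<Rightarrow> 'm tb \<Rightarrow> 'n tb" where
  "lift_map x = (\<lambda>(u, v). (x u, \<chi> a. \<Sum>\<alpha>\<in>UNIV. B_tan x a \<alpha> u * (v $ \<alpha>)))"

text \<open>\<open>B\<^sup>a\<^sub>0\<^sub>\<beta> = (\<partial>\<^sup>2x\<^sup>a/\<partial>u\<^sup>\<alpha>\<partial>u\<^sup>\<beta>) v\<^sup>\<alpha>\<close>.\<close>
definition B_zero ::
    "(real^'m::finite \<Rightarrow> real^'n::finite) \<Rightarrow> 'n \<Rightarrow> 'm \<Rightarrow> 'm tb \<Rightarrow> real" where
  "B_zero x a \<beta> z = (\<Sum>\<alpha>\<in>UNIV. partial \<alpha> (partial \<beta> (\<lambda>u. x u $ a)) (fst z) * (snd z $ \<alpha>))"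

definition moving_frame ::
    "('m tb) set \<Rightarrow> (real^'m::finite \<Rightarrow> real^'n::finite) \<Rightarrow>
     ('k::finite \<Rightarrow> 'm tb \<Rightarrow> real^'n) \<Rightarrow>
     ('m \<Rightarrow> 'm tb \<Rightarrow> real^'n) \<Rightarrow>
     ('k \<Rightarrow> 'm tb \<Rightarrow> real^'n) \<Rightarrow> bool" where
  "moving_frame W x E T Q \<longleftrightarrow>
     (\<forall>\<alpha>'. smooth_on W (E \<alpha>')) \<and>
     (\<forall>z\<in>W.
        (\<forall>\<alpha> \<beta>. (\<Sum>a\<in>UNIV. B_tan x a \<beta> (fst z) * T \<alpha> z $ a) = (if \<alpha> = \<beta> then 1 else 0)) \<and>
        (\<forall>\<alpha>' \<beta>. (\<Sum>a\<in>UNIV. B_tan x a \<beta> (fst z) * Q \<alpha>' z $ a) = 0) \<and>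
        (\<forall>\<alpha> \<beta>'. (\<Sum>a\<in>UNIV. T \<alpha> z $ a * E \<beta>' z $ a) = 0) \<and>
        (\<forall>\<alpha>' \<beta>'. (\<Sum>a\<in>UNIV. Q \<alpha>' z $ a * E \<beta>' z $ a) = (if \<alpha>' = \<beta>' then 1 else 0)) \<and>
        (\<forall>a b. (\<Sum>\<alpha>\<in>UNIV. B_tan x a \<alpha> (fst z) * T \<alpha> z $ b)
               + (\<Sum>\<alpha>'\<in>UNIV. E \<alpha>' z $ a * Q \<alpha>' z $ b) = (if a = b then 1 else 0)))"

text \<open>\<open>B\<^sup>a\<^sub>0\<^sub>\<beta> + N\<^sup>a\<^sub>b B\<^sup>b\<^sub>\<beta>\<close>, whose tangential and normal parts are \<open>ind_N\<close> and \<open>ind_K\<close>.\<close>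
definition BN :: "('n::finite tb \<Rightarrow> real) \<Rightarrow> (real^'m::finite \<Rightarrow> real^'n) \<Rightarrow>
     'n \<Rightarrow> 'm \<Rightarrow> 'm tb \<Rightarrow> real" where
  "BN f x a \<beta> z = B_zero x a \<beta> z
     + (\<Sum>b\<in>UNIV. cartan_N f a b (lift_map x z) * B_tan x b \<beta> (fst z))"

definition ind_N :: "('n::finite tb \<Rightarrow> real) \<Rightarrow> (real^'m::finite \<Rightarrow> real^'n) \<Rightarrow>
     ('m \<Rightarrow> 'm tb \<Rightarrow> real^'n) \<Rightarrow> 'm \<Rightarrow> 'm \<Rightarrow> 'm tb \<Rightarrow> real" where
  "ind_N f x T \<alpha> \<beta> z = (\<Sum>a\<in>UNIV. T \<alpha> z $ a * BN f x a \<beta> z)"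

definition ind_K :: "('n::finite tb \<Rightarrow> real) \<Rightarrow> (real^'m::finite \<Rightarrow> real^'n) \<Rightarrow>
     ('k::finite \<Rightarrow> 'm tb \<Rightarrow> real^'n) \<Rightarrow> 'k \<Rightarrow> 'm \<Rightarrow> 'm tb \<Rightarrow> real" where
  "ind_K f x Q \<alpha>' \<beta> z = (\<Sum>a\<in>UNIV. Q \<alpha>' z $ a * BN f x a \<beta> z)"

text \<open>The adapted derivation \<open>\<delta>/\<delta>u\<^sup>\<delta>\<close> of a nonlinear connection \<open>N\<close> on the submanifold.\<close>
definition delta_u :: "('m::finite \<Rightarrow> 'm \<Rightarrow> 'm tb \<Rightarrow> real) \<Rightarrow> 'm \<Rightarrow>
     ('m tb \<Rightarrow> real) \<Rightarrow> 'm tb \<Rightarrow> real" where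
  "delta_u N \<delta> s z = pd_pos \<delta> s z - (\<Sum>\<beta>\<in>UNIV. N \<beta> \<delta> z * pd_dir \<beta> s z)"

text \<open>A 1-form in the coordinates \<open>(u, v)\<close> maps a point \<open>z\<close> and a tangent vector
  \<open>\<xi> = (du, dv)\<close> to a real; below are \<open>du\<^sup>\<delta>\<close> and \<open>\<delta>v\<^sup>\<delta> = dv\<^sup>\<delta> + N\<^sup>\<delta>\<^sub>\<beta> du\<^sup>\<beta>\<close>.\<close>
type_synonym 'm form1 = "'m tb \<Rightarrow> 'm tb \<Rightarrow> real"

definition form_du :: "'m::finite \<Rightarrow> 'm form1" where
  "form_du \<delta> z \<xi> = fst \<xi> $ \<delta>"

definition form_deltav ::
    "('m::finite \<Rightarrow> 'm \<Rightarrow> 'm tb \<Rightarrow> real) \<Rightarrow> 'm \<Rightarrow> 'm form1" where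
  "form_deltav N \<delta> z \<xi> = snd \<xi> $ \<delta> + (\<Sum>\<beta>\<in>UNIV. N \<delta> \<beta> z * form_du \<beta> z \<xi>)"

text \<open>The 1-form \<open>L\<^sub>\<delta> du\<^sup>\<delta> + C\<^sub>\<delta> \<delta>v\<^sup>\<delta>\<close>.\<close>
definition adapted_form :: "('m::finite \<Rightarrow> 'm \<Rightarrow> 'm tb \<Rightarrow> real) \<Rightarrow>
     ('m \<Rightarrow> 'm tb \<Rightarrow> real) \<Rightarrow> ('m \<Rightarrow> 'm tb \<Rightarrow> real) \<Rightarrow> 'm form1" where
  "adapted_form N L C z \<xi> =
     (\<Sum>\<delta>\<in>UNIV. L \<delta> z * form_du \<delta> z \<xi>) + (\<Sum>\<delta>\<in>UNIV. C \<delta> z * form_deltav N \<delta> z \<xi>)"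

text \<open>The coupling. The arguments \<open>L\<close>, \<open>C\<close> are either the H- or the V-coefficients of the Cartan
  connection.\<close>

definition coupling_L :: "('n::finite tb \<Rightarrow> real) \<Rightarrow> (real^'m::finite \<Rightarrow> real^'n) \<Rightarrow>
     ('k::finite \<Rightarrow> 'm tb \<Rightarrow> real^'n) \<Rightarrow> ('k \<Rightarrow> 'm tb \<Rightarrow> real^'n) \<Rightarrow>
     'n coeffs \<Rightarrow> 'n coeffs \<Rightarrow> 'n \<Rightarrow> 'n \<Rightarrow> 'm \<Rightarrow> 'm tb \<Rightarrow> real" where
  "coupling_L f x E Q L C a b \<delta> z =
     (\<Sum>d\<in>UNIV. L a b d (lift_map x z) * B_tan x d \<delta> (fst z))
     + (\<Sum>d\<in>UNIV. \<Sum>\<delta>'\<in>UNIV. C a b d (lift_map x z) * E \<delta>' z $ d * ind_K f x Q \<delta>' \<delta> z)"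

definition coupling_C :: "(real^'m::finite \<Rightarrow> real^'n::finite) \<Rightarrow> 'n coeffs \<Rightarrow>
     'n \<Rightarrow> 'n \<Rightarrow> 'm \<Rightarrow> 'm tb \<Rightarrow> real" where
  "coupling_C x C a b \<delta> z = (\<Sum>d\<in>UNIV. C a b d (lift_map x z) * B_tan x d \<delta> (fst z))"

definition coupling_form :: "('n::finite tb \<Rightarrow> real) \<Rightarrow> (real^'m::finite \<Rightarrow> real^'n) \<Rightarrow>
     ('k::finite \<Rightarrow> 'm tb \<Rightarrow> real^'n) \<Rightarrow> ('m \<Rightarrow> 'm tb \<Rightarrow> real^'n) \<Rightarrow>
     ('k \<Rightarrow> 'm tb \<Rightarrow> real^'n) \<Rightarrow> 'n coeffs \<Rightarrow> 'n coeffs \<Rightarrow> 'n \<Rightarrow> 'n \<Rightarrow> 'm form1" where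
  "coupling_form f x E T Q L C a b =
     adapted_form (ind_N f x T) (coupling_L f x E Q L C a b) (coupling_C x C a b)"

text \<open>\<open>(D X)\<^sup>a = dX\<^sup>a + \<omega>\<^sup>a\<^sub>b X\<^sup>b\<close> with \<open>\<omega>\<close> the coupling form.\<close>
definition coupling_D :: "('n::finite tb \<Rightarrow> real) \<Rightarrow> (real^'m::finite \<Rightarrow> real^'n) \<Rightarrow>
     ('k::finite \<Rightarrow> 'm tb \<Rightarrow> real^'n) \<Rightarrow> ('m \<Rightarrow> 'm tb \<Rightarrow> real^'n) \<Rightarrow>
     ('k \<Rightarrow> 'm tb \<Rightarrow> real^'n) \<Rightarrow> 'n coeffs \<Rightarrow> 'n coeffs \<Rightarrow>
     ('m tb \<Rightarrow> real^'n) \<Rightarrow> 'n \<Rightarrow> 'm form1" where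
  "coupling_D f x E T Q L C X a z \<xi> = frechet_derivative (\<lambda>w. X w $ a) (at z) \<xi>
     + (\<Sum>b\<in>UNIV. coupling_form f x E T Q L C a b z \<xi> * X z $ b)"

definition normal_D :: "('n::finite tb \<Rightarrow> real) \<Rightarrow> (real^'m::finite \<Rightarrow> real^'n) \<Rightarrow>
     ('k::finite \<Rightarrow> 'm tb \<Rightarrow> real^'n) \<Rightarrow> ('m \<Rightarrow> 'm tb \<Rightarrow> real^'n) \<Rightarrow>
     ('k \<Rightarrow> 'm tb \<Rightarrow> real^'n) \<Rightarrow> 'n coeffs \<Rightarrow> 'n coeffs \<Rightarrow>
     ('m tb \<Rightarrow> real^'k) \<Rightarrow> 'k \<Rightarrow> 'm form1" where
  "normal_D f x E T Q L C X \<alpha>' z \<xi> =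
     (\<Sum>b\<in>UNIV. Q \<alpha>' z $ b *
        coupling_D f x E T Q L C (\<lambda>w. \<Sum>\<gamma>'\<in>UNIV. (X w $ \<gamma>') *\<^sub>R E \<gamma>' w) b z \<xi>)"

text \<open>\<open>\<omega>\<close> is the matrix of connection 1-forms on \<open>W\<close> of an operator \<open>D\<close> acting on the components
  of normal fields: \<open>D X\<^sup>\<alpha> = dX\<^sup>\<alpha> + X\<^sup>\<beta> \<omega>\<^sup>\<alpha>\<^sub>\<beta>\<close> for all smooth \<open>X\<close>; \<open>\<omega> \<alpha> \<beta>\<close> is \<open>\<omega>\<^sup>\<alpha>\<^sub>\<beta>\<close>.\<close>
definition connection_forms :: "('m tb) set \<Rightarrow>
     (('m::finite tb \<Rightarrow> real^'k::finite) \<Rightarrow> 'k \<Rightarrow> 'm form1) \<Rightarrow>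
     ('k \<Rightarrow> 'k \<Rightarrow> 'm form1) \<Rightarrow> bool" where
  "connection_forms W D \<omega> \<longleftrightarrow>
     (\<forall>\<alpha>' \<beta>'. \<forall>z\<in>W. linear (\<omega> \<alpha>' \<beta>' z)) \<and>
     (\<forall>X. smooth_on W X \<longrightarrow> (\<forall>\<alpha>'. \<forall>z\<in>W. \<forall>\<xi>.
        D X \<alpha>' z \<xi> = frechet_derivative (\<lambda>w. X w $ \<alpha>') (at z) \<xi>
                    + (\<Sum>\<beta>'\<in>UNIV. X z $ \<beta>' * \<omega> \<alpha>' \<beta>' z \<xi>)))"

end

theory Submission
  imports Defs
begin

text \<open>The identity \<open>ds = (\<delta>s/\<delta>u\<^sup>\<delta>) du\<^sup>\<delta> + (\<partial>s/\<partial>v\<^sup>\<delta>) \<delta>v\<^sup>\<delta>\<close> holds for any nonlinear connection. With the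
  Leibniz rule and \<open>B\<^sup>\<alpha>\<^sup>'\<^sub>a B\<^sup>a\<^sub>\<beta>\<^sub>' = \<delta>\<^sup>\<alpha>\<^sup>'\<^sub>\<beta>\<^sub>'\<close> it shows that the forms of the theorem are connection
  forms. Conversely, connection forms are determined by the derivatives of the constant fields
  \<open>X\<^sup>\<alpha>\<^sup>' = \<delta>\<^sup>\<alpha>\<^sup>'\<^sub>\<beta>\<^sub>'\<close>. No property of the coefficients of \<open>D\<close> enters, so the H- and the V-case are
  two instances of one statement.\<close>

lemma smooth_on_const: "smooth_on S (\<lambda>_. c)"
proof -
  have "Ck_on k (\<lambda>_. c) S" for k
    \<comment> \<open>The derivative of a constant is the constant 0, so the induction must range
      over all constants.\<close>
    by (induction k arbitrary: c) simp_all
  then show ?thesis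
    by (simp add: smooth_on_def)
qed

lemma smooth_on_imp_differentiable:
  assumes "smooth_on S f" "z \<in> S"
  shows "f differentiable (at z)"
proof -
  have "Ck_on (Suc 0) f S"
    using assms(1) by (simp only: smooth_on_def)
  then show ?thesis
    using assms(2) by simp
qed

lemma differentiable_vec_nth:
  assumes "f differentiable F"
  shows "(\<lambda>w. f w $ j) differentiable F"
  using assms bounded_linear.has_derivative[OF bounded_linear_vec_nth]
  unfolding differentiable_def by blast

text \<open>With the next two lemmas: \<open>adapted_form\<close> is linear over functions in its
  pair of coefficient families. This lets the sums over \<open>d\<close> and \<open>e\<close> and
  the factors \<open>Q \<alpha>' w $ d\<close> be pulled out of the coefficients of the normal
  forms.\<close>

lemma adapted_form_add:
  "adapted_form N (\<lambda>\<delta> w. L \<delta> w + L' \<delta> w) (\<lambda>\<delta> w. C \<delta> w + C' \<delta> w) z \<xi> =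
   adapted_form N L C z \<xi> + adapted_form N L' C' z \<xi>"
  by (simp add: adapted_form_def distrib_right sum.distrib)

lemma adapted_form_mult:
  "adapted_form N (\<lambda>\<delta> w. g w * L \<delta> w) (\<lambda>\<delta> w. g w * C \<delta> w) z \<xi> =
   g z * adapted_form N L C z \<xi>"
  by (simp add: adapted_form_def distrib_left sum_distrib_left mult.assoc)

lemma adapted_form_sum:
  "adapted_form N (\<lambda>\<delta> w. \<Sum>j\<in>J. L j \<delta> w) (\<lambda>\<delta> w. \<Sum>j\<in>J. C j \<delta> w) z \<xi> =
   (\<Sum>j\<in>J. adapted_form N (L j) (C j) z \<xi>)"
  by (simp add: adapted_form_def sum_distrib_right sum.distrib
      sum.swap[where A = J and B = UNIV])

lemma linear_adapted_form: "linear (adapted_form N L C z)"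
  by (rule linearI)
    (simp_all add: adapted_form_def form_du_def form_deltav_def algebra_simps
      sum.distrib sum_distrib_left)

text \<open>Expand \<xi> in the standard bases of the position and the direction factor and use
  linearity of the derivative.\<close>

lemma frechet_derivative_coordinates:
  fixes s :: "'m::finite tb \<Rightarrow> real"
  assumes "s differentiable (at z)"
  shows "frechet_derivative s (at z) \<xi> =
    (\<Sum>\<delta>\<in>UNIV. pd_pos \<delta> s z * fst \<xi> $ \<delta>) + (\<Sum>\<delta>\<in>UNIV. pd_dir \<delta> s z * snd \<xi> $ \<delta>)"
proof -
  interpret linear "frechet_derivative s (at z)"
    using assms by (rule linear_frechet_derivative)
  have "\<xi> = (\<Sum>\<delta>\<in>UNIV. fst \<xi> $ \<delta> *\<^sub>R (axis \<delta> 1, 0)) + (\<Sum>\<delta>\<in>UNIV. snd \<xi> $ \<delta> *\<^sub>R (0, axis \<delta> 1))"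
    by (simp add: prod_eq_iff fst_sum snd_sum basis_expansion flip: scalar_mult_eq_scaleR)
  then have "frechet_derivative s (at z) \<xi> = frechet_derivative s (at z)
    ((\<Sum>\<delta>\<in>UNIV. fst \<xi> $ \<delta> *\<^sub>R (axis \<delta> 1, 0)) + (\<Sum>\<delta>\<in>UNIV. snd \<xi> $ \<delta> *\<^sub>R (0, axis \<delta> 1)))"
    by (rule arg_cong)
  also have "\<dots> = (\<Sum>\<delta>\<in>UNIV. pd_pos \<delta> s z * fst \<xi> $ \<delta>) + (\<Sum>\<delta>\<in>UNIV. pd_dir \<delta> s z * snd \<xi> $ \<delta>)"
    by (simp only: add sum scale real_scaleR_def pd_pos_def pd_dir_def mult.commute)
  finally show ?thesis .
qed

text \<open>Passing from (du, dv) to the adapted coframe adds N-terms to \<open>form_deltav\<close>,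
  and passing to the adapted derivations subtracts the same terms in \<open>delta_u\<close>. Hence
  \<open>N\<close> is arbitrary.\<close>

lemma frechet_derivative_eq_adapted_form:
  assumes "s differentiable (at z)"
  shows "frechet_derivative s (at z) \<xi> =
    adapted_form N (\<lambda>\<delta>. delta_u N \<delta> s) (\<lambda>\<delta>. pd_dir \<delta> s) z \<xi>"
proof -
  \<comment> \<open>The left side comes from \<open>delta_u\<close>, the right side from
    \<open>form_deltav\<close>; they differ only in the names of the summation indices and cancel
    once these are matched.\<close>
  have "(\<Sum>\<delta>\<in>UNIV. \<Sum>\<beta>\<in>UNIV. fst \<xi> $ \<delta> * (N \<beta> \<delta> z * pd_dir \<beta> s z)) =
    (\<Sum>\<delta>\<in>UNIV. \<Sum>\<beta>\<in>UNIV. fst \<xi> $ \<beta> * (N \<delta> \<beta> z * pd_dir \<delta> s z))"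
    by (rule sum.swap)
  then show ?thesis
    by (simp add: frechet_derivative_coordinates[OF assms] adapted_form_def delta_u_def
        form_du_def form_deltav_def algebra_simps sum.distrib sum_subtractf sum_distrib_left)
qed

text \<open>The form claimed by the theorem, for arbitrary coefficients \<open>L\<close>,
  \<open>C\<close> in place of the H- or V-coefficients. The summation index is called
  \<open>e\<close>, since \<open>f\<close> is the Finsler function in a chart.\<close>

definition normal_form :: "('n::finite tb \<Rightarrow> real) \<Rightarrow> (real^'m::finite \<Rightarrow> real^'n) \<Rightarrow>
     ('k::finite \<Rightarrow> 'm tb \<Rightarrow> real^'n) \<Rightarrow> ('m \<Rightarrow> 'm tb \<Rightarrow> real^'n) \<Rightarrow>
     ('k \<Rightarrow> 'm tb \<Rightarrow> real^'n) \<Rightarrow> 'n coeffs \<Rightarrow> 'n coeffs \<Rightarrow> 'k \<Rightarrow> 'k \<Rightarrow> 'm form1" where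
  "normal_form f x E T Q L C \<alpha>' \<beta>' = adapted_form (ind_N f x T)
     (\<lambda>\<delta> w. \<Sum>d\<in>UNIV. Q \<alpha>' w $ d *
        (delta_u (ind_N f x T) \<delta> (\<lambda>w. E \<beta>' w $ d) w
         + (\<Sum>e\<in>UNIV. E \<beta>' w $ e * coupling_L f x E Q L C d e \<delta> w)))
     (\<lambda>\<delta> w. \<Sum>d\<in>UNIV. Q \<alpha>' w $ d *
        (pd_dir \<delta> (\<lambda>w. E \<beta>' w $ d) w
         + (\<Sum>e\<in>UNIV. E \<beta>' w $ e * coupling_C x C d e \<delta> w)))"

text \<open>The adapted derivatives of \<open>E \<beta>'\<close> reassemble to its differential and
  the coupling coefficients to the coupling form. So the normal form is the normal part of the
  coupling derivative of a frame vector.\<close>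

lemma normal_form_eq_coupling_D:
  assumes "E \<beta>' differentiable (at z)"
  shows "normal_form f x E T Q L C \<alpha>' \<beta>' z \<xi> =
    (\<Sum>d\<in>UNIV. Q \<alpha>' z $ d * coupling_D f x E T Q L C (E \<beta>') d z \<xi>)"
proof -
  have "(\<lambda>w. E \<beta>' w $ d) differentiable (at z)" for d
    using assms by (rule differentiable_vec_nth)
  then show ?thesis
    by (simp add: normal_form_def adapted_form_sum adapted_form_mult adapted_form_add
        coupling_D_def coupling_form_def mult.commute
        flip: frechet_derivative_eq_adapted_form)
qed

text \<open>Leibniz rule for the differential part; the part with the coupling form is linear over
  functions.\<close>

lemma coupling_D_normal_field:
  fixes E :: "'k::finite \<Rightarrow> 'm::finite tb \<Rightarrow> real^'n::finite"
  assumes E: "\<And>\<gamma>. E \<gamma> differentiable (at z)" and X: "X differentiable (at z)"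
  shows "coupling_D f x E T Q L C (\<lambda>w. \<Sum>\<gamma>\<in>UNIV. X w $ \<gamma> *\<^sub>R E \<gamma> w) a z \<xi> =
    (\<Sum>\<gamma>\<in>UNIV. frechet_derivative (\<lambda>w. X w $ \<gamma>) (at z) \<xi> * E \<gamma> z $ a) +
    (\<Sum>\<gamma>\<in>UNIV. X z $ \<gamma> * coupling_D f x E T Q L C (E \<gamma>) a z \<xi>)"
proof -
  have dX: "((\<lambda>w. X w $ \<gamma>) has_derivative frechet_derivative (\<lambda>w. X w $ \<gamma>) (at z)) (at z)"
    and dE: "((\<lambda>w. E \<gamma> w $ a) has_derivative frechet_derivative (\<lambda>w. E \<gamma> w $ a) (at z)) (at z)" for \<gamma>
    using differentiable_vec_nth[OF X] differentiable_vec_nth[OF E]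
    by (simp_all add: frechet_derivative_works)
  have "((\<lambda>w. (\<Sum>\<gamma>\<in>UNIV. X w $ \<gamma> *\<^sub>R E \<gamma> w) $ a) has_derivative
      (\<lambda>\<xi>. \<Sum>\<gamma>\<in>UNIV. X z $ \<gamma> * frechet_derivative (\<lambda>w. E \<gamma> w $ a) (at z) \<xi> +
        frechet_derivative (\<lambda>w. X w $ \<gamma>) (at z) \<xi> * E \<gamma> z $ a)) (at z)"
    unfolding sum_component vector_scaleR_component real_scaleR_def
    by (intro has_derivative_sum has_derivative_mult dX dE)
  then have "frechet_derivative (\<lambda>w. (\<Sum>\<gamma>\<in>UNIV. X w $ \<gamma> *\<^sub>R E \<gamma> w) $ a) (at z) \<xi> =
      (\<Sum>\<gamma>\<in>UNIV. X z $ \<gamma> * frechet_derivative (\<lambda>w. E \<gamma> w $ a) (at z) \<xi> +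
        frechet_derivative (\<lambda>w. X w $ \<gamma>) (at z) \<xi> * E \<gamma> z $ a)"
    by (rule fun_cong[OF frechet_derivative_at, symmetric])
  moreover have "(\<Sum>b\<in>UNIV. \<Sum>\<gamma>\<in>UNIV. X z $ \<gamma> * (E \<gamma> z $ b * coupling_form f x E T Q L C a b z \<xi>)) =
      (\<Sum>\<gamma>\<in>UNIV. \<Sum>b\<in>UNIV. X z $ \<gamma> * (E \<gamma> z $ b * coupling_form f x E T Q L C a b z \<xi>))"
    by (rule sum.swap)
  ultimately show ?thesis
    by (simp add: coupling_D_def sum_component algebra_simps sum.distrib sum_distrib_left)
qed

text \<open>Contract the Leibniz rule with \<open>Q \<alpha>'\<close>. By duality only the
  differential of the component \<alpha>' survives in the first sum, and the second sum consists of
  normal forms.\<close>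

lemma normal_D_eq:
  fixes E Q :: "'k::finite \<Rightarrow> 'm::finite tb \<Rightarrow> real^'n::finite"
  assumes E: "\<And>\<gamma>. E \<gamma> differentiable (at z)" and X: "X differentiable (at z)"
    and QE: "\<And>\<gamma>. (\<Sum>a\<in>UNIV. Q \<alpha>' z $ a * E \<gamma> z $ a) = (if \<alpha>' = \<gamma> then 1 else 0)"
  shows "normal_D f x E T Q L C X \<alpha>' z \<xi> = frechet_derivative (\<lambda>w. X w $ \<alpha>') (at z) \<xi> +
    (\<Sum>\<gamma>\<in>UNIV. X z $ \<gamma> * normal_form f x E T Q L C \<alpha>' \<gamma> z \<xi>)"
proof -
  let ?dX = "\<lambda>\<gamma>. frechet_derivative (\<lambda>w. X w $ \<gamma>) (at z) \<xi>"
  let ?D = "\<lambda>\<gamma> a. coupling_D f x E T Q L C (E \<gamma>) a z \<xi>"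
  have "normal_D f x E T Q L C X \<alpha>' z \<xi> =
      (\<Sum>a\<in>UNIV. \<Sum>\<gamma>\<in>UNIV. ?dX \<gamma> * (Q \<alpha>' z $ a * E \<gamma> z $ a)) +
      (\<Sum>a\<in>UNIV. \<Sum>\<gamma>\<in>UNIV. X z $ \<gamma> * (Q \<alpha>' z $ a * ?D \<gamma> a))"
    by (simp add: normal_D_def coupling_D_normal_field[OF E X] distrib_left sum.distrib
        sum_distrib_left mult.left_commute)
  also have "\<dots> = (\<Sum>\<gamma>\<in>UNIV. ?dX \<gamma> * (\<Sum>a\<in>UNIV. Q \<alpha>' z $ a * E \<gamma> z $ a)) +
      (\<Sum>\<gamma>\<in>UNIV. X z $ \<gamma> * (\<Sum>a\<in>UNIV. Q \<alpha>' z $ a * ?D \<gamma> a))"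
    unfolding sum_distrib_left by (intro arg_cong2[where f = "(+)"] sum.swap)
  finally show ?thesis
    by (simp add: QE normal_form_eq_coupling_D[where T = T, OF E] if_distrib[where f = "\<lambda>t. _ * t"] cong: if_cong)
qed

text \<open>Both directions compare \<omega> with the formula of \<open>normal_D_eq\<close>. The
  equality is claimed on \<open>W\<close> only, since \<open>connection_forms\<close> constrains
  \<omega> only there.\<close>

lemma connection_forms_normal_D_iff:
  fixes E Q :: "'k::finite \<Rightarrow> 'm::finite tb \<Rightarrow> real^'n::finite"
  assumes frame: "moving_frame W x E T Q"
  shows "connection_forms W (normal_D f x E T Q L C) \<omega> \<longleftrightarrow>
    (\<forall>\<alpha>' \<beta>'. \<forall>z\<in>W. \<forall>\<xi>. \<omega> \<alpha>' \<beta>' z \<xi> = normal_form f x E T Q L C \<alpha>' \<beta>' z \<xi>)"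
    (is "?conn \<longleftrightarrow> ?eq")
proof -
  have normal_D: "normal_D f x E T Q L C X \<alpha>' z \<xi> =
      frechet_derivative (\<lambda>w. X w $ \<alpha>') (at z) \<xi> +
      (\<Sum>\<gamma>\<in>UNIV. X z $ \<gamma> * normal_form f x E T Q L C \<alpha>' \<gamma> z \<xi>)"
    if "smooth_on W X" "z \<in> W" for X \<alpha>' z \<xi>
    using frame that
    by (intro normal_D_eq smooth_on_imp_differentiable[of W]) (simp_all add: moving_frame_def)
  show ?thesis
  proof
    assume conn: ?conn
    show ?eq
    proof (intro allI ballI)
      fix \<alpha>' \<beta>' z \<xi>
      assume z: "z \<in> W"
      \<comment> \<open>This test field represents the frame vector \<open>E \<beta>'\<close>; its
        components select the single summand \<gamma> = \<beta>'.\<close>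
      let ?X = "\<lambda>_. axis \<beta>' 1 :: real^'k"
      have "normal_D f x E T Q L C ?X \<alpha>' z \<xi> = frechet_derivative (\<lambda>w. ?X w $ \<alpha>') (at z) \<xi> +
          (\<Sum>\<gamma>\<in>UNIV. ?X z $ \<gamma> * \<omega> \<alpha>' \<gamma> z \<xi>)"
        using conn z smooth_on_const unfolding connection_forms_def by blast
      \<comment> \<open>Both expressions for the normal derivative contain the same differential of
        the test field, which cancels without being evaluated.\<close>
      then have "(\<Sum>\<gamma>\<in>UNIV. ?X z $ \<gamma> * \<omega> \<alpha>' \<gamma> z \<xi>) =
          (\<Sum>\<gamma>\<in>UNIV. ?X z $ \<gamma> * normal_form f x E T Q L C \<alpha>' \<gamma> z \<xi>)"
        unfolding normal_D[OF smooth_on_const z] by (rule add_left_imp_eq[OF sym])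
      then show "\<omega> \<alpha>' \<beta>' z \<xi> = normal_form f x E T Q L C \<alpha>' \<beta>' z \<xi>"
        by (simp add: axis_def if_distrib[where f = "\<lambda>t. t * _"] cong: if_cong)
    qed
  next
    assume eq: ?eq
    \<comment> \<open>Equality as functions of \<xi> carries the linearity of
      \<open>adapted_form\<close> over to \<omega>.\<close>
    then have "\<omega> \<alpha>' \<beta>' z = normal_form f x E T Q L C \<alpha>' \<beta>' z" if "z \<in> W" for \<alpha>' \<beta>' z
      using that by blast
    then show ?conn
      by (simp add: connection_forms_def normal_D normal_form_def linear_adapted_form)
  qed
qed

theorem theorem2p5:
  fixes A :: "('p::{t2_space,second_countable_topology}, 'n::finite) chart set"
    and A' :: "('q::{t2_space,second_countable_topology}, 'm::finite) chart set"
    and F :: "'p \<Rightarrow> ('p, 'n) tvec \<Rightarrow> real"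
    and i :: "'q \<Rightarrow> 'p"
    and p :: real
    and c :: "('p, 'n) chart" and c' :: "('q, 'm) chart"
    and W :: "('m tb) set"
    and E Q :: "'k::finite \<Rightarrow> 'm tb \<Rightarrow> real^'n"
    and T :: "'m \<Rightarrow> 'm tb \<Rightarrow> real^'n"
    and \<omega>H \<omega>V :: "'k \<Rightarrow> 'k \<Rightarrow> 'm form1"
    and f :: "'n tb \<Rightarrow> real"
    and x :: "real^'m \<Rightarrow> real^'n"
    and N :: "'m \<Rightarrow> 'm \<Rightarrow> 'm tb \<Rightarrow> real"
  assumes dims: "1 < CARD('m)" "CARD('m) < CARD('n)" "CARD('k) = CARD('n) - CARD('m)"
    and M: "smooth_atlas A"
    and subM: "smooth_atlas A'"
    and finsler: "finsler_function A F"
    and imm: "smooth_immersion A' A i"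
    and p: "0 < p"
    and charts: "c \<in> A" "c' \<in> A'"
    and W: "open W" "W \<subseteq> local_dom c' c i \<times> (UNIV - {0})"
    and f: "f = local_rep A F c"
    and x: "x = local_map c' c i"
    and N: "N = ind_N f x T"
    and frame: "moving_frame W x E T Q"
  shows "(connection_forms W
            (normal_D f x E T Q (cartan_LH f) (cartan_CH f)) \<omega>H \<longleftrightarrow>
          (\<forall>\<alpha>' \<beta>'. \<forall>z\<in>W. \<forall>\<xi>. \<omega>H \<alpha>' \<beta>' z \<xi> =
             adapted_form N
               (\<lambda>\<delta> w. \<Sum>d\<in>UNIV. Q \<alpha>' w $ d *
                  (delta_u N \<delta> (\<lambda>w. E \<beta>' w $ d) w
                   + (\<Sum>e\<in>UNIV. E \<beta>' w $ e * coupling_L f x E Q (cartan_LH f) (cartan_CH f) d e \<delta> w)))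
               (\<lambda>\<delta> w. \<Sum>d\<in>UNIV. Q \<alpha>' w $ d *
                  (pd_dir \<delta> (\<lambda>w. E \<beta>' w $ d) w
                   + (\<Sum>e\<in>UNIV. E \<beta>' w $ e * coupling_C x (cartan_CH f) d e \<delta> w)))
               z \<xi>)) \<and>
         (connection_forms W
            (normal_D f x E T Q (cartan_LV p f) (cartan_CV p f)) \<omega>V \<longleftrightarrow>
          (\<forall>\<alpha>' \<beta>'. \<forall>z\<in>W. \<forall>\<xi>. \<omega>V \<alpha>' \<beta>' z \<xi> =
             adapted_form N
               (\<lambda>\<delta> w. \<Sum>d\<in>UNIV. Q \<alpha>' w $ d *
                  (delta_u N \<delta> (\<lambda>w. E \<beta>' w $ d) w
                   + (\<Sum>e\<in>UNIV. E \<beta>' w $ e * coupling_L f x E Q (cartan_LV p f) (cartan_CV p f) d e \<delta> w)))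
               (\<lambda>\<delta> w. \<Sum>d\<in>UNIV. Q \<alpha>' w $ d *
                  (pd_dir \<delta> (\<lambda>w. E \<beta>' w $ d) w
                   + (\<Sum>e\<in>UNIV. E \<beta>' w $ e * coupling_C x (cartan_CV p f) d e \<delta> w)))
               z \<xi>))"
  unfolding N connection_forms_normal_D_iff[OF frame] normal_form_def by (intro conjI refl)

end
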